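(* Let $d\ge1$, let $J\colon\mathbb{R}^d\to(0,\infty)$ be a measurable kernel, and let $J_\varepsilon(x)=\varepsilon^dJ(\varepsilon x)$ for $\varepsilon>0$. Assume that $(1\wedge|x|)J_\varepsilon(x)\in L^1(\mathbb{R}^d)$ for all $\varepsilon>0$ and that $\ell(s)=\int_{|x|>s}J(x)\,\mathrm{d}x$ is slowly varying at zero. Then for every Borel set $E\subset\mathbb{R}^d$ of finite Lebesgue measure and of finite perimeter $$\lim_{\varepsilon\downarrow0}\ell(\varepsilon)^{-1}\,\mathrm{Per}_{J_\varepsilon}(E)=|E|.$$
   Context: $a\wedge b=\min(a,b)$; $|E|$ is Lebesgue measure. $\mathrm{Per}_J(E)=\int_E\int_{E^c}J(x-y)\,\mathrm{d}y\,\mathrm{d}x$. A function $\ell$ is slowly varying at zero if $\lim_{s\downarrow0}\ell(\lambda s)/\ell(s)=1$ for every $\lambda>0$. $E$ has finite perimeter if $|D\mathbf{1}_E|(\mathbb{R}^d)<\infty$, where $D\mathbf{1}_E$ is the distributional gradient of $\mathbf 1_E$. *)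

theory Defs
  imports "HOL-Analysis.Analysis"
begin

primrec continuously_differentiable ::
  "nat \<Rightarrow> ('a::euclidean_space \<Rightarrow> 'b::real_normed_vector) \<Rightarrow> bool" where
  "continuously_differentiable 0 f \<longleftrightarrow> continuous_on UNIV f"
| "continuously_differentiable (Suc k) f \<longleftrightarrow>
     (\<forall>x. f differentiable (at x)) \<and>
     (\<forall>v. continuously_differentiable k (\<lambda>x. frechet_derivative f (at x) v))"

definition test_fields :: "('a::euclidean_space \<Rightarrow> 'a) set" where
  "test_fields = {\<phi>. (\<forall>k. continuously_differentiable k \<phi>) \<and> compact (closure {x. \<phi> x \<noteq> 0})}"

definition divergence :: "('a::euclidean_space \<Rightarrow> 'a) \<Rightarrow> 'a \<Rightarrow> real" where
  "divergence \<phi> x = (\<Sum>b\<in>Basis. frechet_derivative \<phi> (at x) b \<bullet> b)"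

text \<open>The distributional gradient of a locally integrable function, as a functional on
  smooth compactly supported vector fields.\<close>

definition distributional_gradient ::
  "('a::euclidean_space \<Rightarrow> real) \<Rightarrow> ('a \<Rightarrow> 'a) \<Rightarrow> real" where
  "distributional_gradient u \<phi> = - (\<integral>x. u x * divergence \<phi> x \<partial>lebesgue)"

text \<open>The total variation over the whole space of a vector-valued distribution; it is finite
  exactly when the distribution is a finite vector-valued Radon measure, and is then the total
  mass of the variation measure.\<close>

definition total_variation :: "(('a::euclidean_space \<Rightarrow> 'a) \<Rightarrow> real) \<Rightarrow> ereal" where
  "total_variation T = (SUP \<phi>\<in>{\<phi> \<in> test_fields. \<forall>x. norm (\<phi> x) \<le> 1}. ereal (T \<phi>))"

definition finite_perimeter :: "'a::euclidean_space set \<Rightarrow> bool" where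
  "finite_perimeter E \<longleftrightarrow> total_variation (distributional_gradient (indicat_real E)) < \<infinity>"

definition Per :: "('a::euclidean_space \<Rightarrow> real) \<Rightarrow> 'a set \<Rightarrow> ennreal" where
  "Per J E = (\<integral>\<^sup>+x\<in>E. (\<integral>\<^sup>+y\<in>- E. ennreal (J (x - y)) \<partial>lebesgue) \<partial>lebesgue)"

definition rescaled_kernel ::
  "('a::euclidean_space \<Rightarrow> real) \<Rightarrow> real \<Rightarrow> 'a \<Rightarrow> real" where
  "rescaled_kernel J \<epsilon> x = \<epsilon> ^ DIM('a) * J (\<epsilon> *\<^sub>R x)"

definition tail_mass :: "('a::euclidean_space \<Rightarrow> real) \<Rightarrow> real \<Rightarrow> real" where
  "tail_mass J s = (LINT x:{x. norm x > s}|lebesgue. J x)"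

definition slowly_varying_at_zero :: "(real \<Rightarrow> real) \<Rightarrow> bool" where
  "slowly_varying_at_zero l \<longleftrightarrow>
     (\<forall>c>0. ((\<lambda>s. l (c * s) / l s) \<longlongrightarrow> 1) (at_right 0))"

end

theory Submission
  imports Defs
begin

text \<open>
  Substituting \<open>u = \<epsilon> (x - y)\<close> turns the perimeter of the rescaled kernel into the average
  \<open>\<integral> J(u) g(u / \<epsilon>) du\<close>, where \<open>g(h) = |E \ (E + h)|\<close> is bounded by \<open>|E|\<close>, tends to \<open>|E|\<close> at
  infinity and satisfies \<open>g(h) \<le> V |h|\<close> because \<open>E\<close> has finite perimeter. Slow variation of the
  tail mass \<open>\<ell>\<close> shows that the region \<open>|u| > R \<epsilon>\<close> carries mass \<open>\<ell>(R \<epsilon>) \<sim> \<ell>(\<epsilon>)\<close>,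
  while a dyadic decomposition gives \<open>\<integral>\<^bsub>|u| \<le> \<epsilon>\<^esub> |u| J(u) du = o(\<epsilon> \<ell>(\<epsilon>))\<close>, so that the
  region \<open>|u| \<le> \<epsilon>\<close> is negligible.
\<close>

section \<open>Smooth bump functions\<close>

text \<open>This is t^(-m) exp(-1/t) extended by 0. The exponent \<open>m\<close> is carried along
  because differentiation raises it, so the family is closed under derivatives up to linear
  combinations.\<close>

definition flat_exp :: "nat \<Rightarrow> real \<Rightarrow> real" where
  "flat_exp m t = (if t \<le> 0 then 0 else inverse t ^ m / exp (inverse t))"

text \<open>With s = 1/t the right-hand limit is that of s^m / exp s at infinity. The lemma also
  supplies the derivative at 0 for the next lower exponent.\<close>

lemma flat_exp_tendsto_0: "(flat_exp m \<longlongrightarrow> 0) (at 0)"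
proof (rule filterlim_split_at)
  have "((\<lambda>t. inverse t ^ m / exp (inverse t)) \<longlongrightarrow> (0::real)) (at_right 0)"
    by (rule filterlim_compose[OF tendsto_power_div_exp_0 filterlim_inverse_at_top_right])
  then show "(flat_exp m \<longlongrightarrow> 0) (at_right 0)"
    by (rule Lim_transform_eventually)
      (auto simp: flat_exp_def eventually_at_filter)
  show "(flat_exp m \<longlongrightarrow> 0) (at_left 0)"
    by (rule tendsto_eventually) (auto simp: flat_exp_def eventually_at_filter)
qed

lemma has_real_derivative_flat_exp:
  "(flat_exp m has_real_derivative flat_exp (m + 2) t - real m * flat_exp (m + 1) t) (at t)"
proof -
  consider "t < 0" | "t = 0" | "t > 0" by linarith
  then show ?thesis
  proof cases
    case 1
    have "((\<lambda>_. 0) has_real_derivative 0) (at t)" by simp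
    then have "(flat_exp m has_real_derivative 0) (at t)"
      by (rule has_field_derivative_transform_within_open[where S = "{..<0}"])
        (use 1 in \<open>auto simp: flat_exp_def\<close>)
    then show ?thesis using 1 by (simp add: flat_exp_def)
  next
    case 2
    \<comment> \<open>The difference quotient at 0 is the family member with exponent one higher. At
      h = 0 both sides are 0, because division by zero yields 0.\<close>
    have "(\<lambda>h. (flat_exp m (0 + h) - flat_exp m 0) / h) = flat_exp (m + 1)"
      by (simp add: flat_exp_def field_simps fun_eq_iff)
    moreover have "flat_exp k 0 = 0" for k by (simp add: flat_exp_def)
    ultimately show ?thesis
      using 2 flat_exp_tendsto_0[of "m + 1"] by (simp only: DERIV_def) simp
  next
    case 3
    have "((\<lambda>t. inverse t ^ m / exp (inverse t)) has_real_derivative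
        flat_exp (m + 2) t - real m * flat_exp (m + 1) t) (at t)"
      using 3
      by (auto intro!: derivative_eq_intros)
        (cases m; simp add: flat_exp_def field_simps power2_eq_square)
    then show ?thesis
      by (rule has_field_derivative_transform_within_open[where S = "{0<..}"])
        (use 3 in \<open>auto simp: flat_exp_def\<close>)
  qed
qed

lemma flat_exp_0_bounds: "0 \<le> flat_exp 0 t" "flat_exp 0 t \<le> 1" "0 < flat_exp 0 t \<longleftrightarrow> 0 < t"
  by (auto simp: flat_exp_def)

text \<open>An algebra of functions closed under directional derivatives consists of smooth functions;
  this one is large enough to contain the standard bumps on balls.\<close>

inductive bump_algebra :: "('a::euclidean_space \<Rightarrow> real) \<Rightarrow> bool" where
  const: "bump_algebra (\<lambda>x. c)"
| inner: "bump_algebra (\<lambda>x. x \<bullet> v)"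
| add: "bump_algebra f \<Longrightarrow> bump_algebra g \<Longrightarrow> bump_algebra (\<lambda>x. f x + g x)"
| mult: "bump_algebra f \<Longrightarrow> bump_algebra g \<Longrightarrow> bump_algebra (\<lambda>x. f x * g x)"
| bump: "bump_algebra (\<lambda>x. flat_exp m (r\<^sup>2 - (x - c) \<bullet> (x - c)))"

text \<open>Sum and product rules preserve the algebra, and only the bump case needs the chain rule.
  Keeping the directional derivatives inside the algebra is what allows iteration to every
  order.\<close>

lemma bump_algebra_has_derivative:
  assumes "bump_algebra f"
  shows "\<exists>f'. (\<forall>x. (f has_derivative f' x) (at x)) \<and> (\<forall>v. bump_algebra (\<lambda>x. f' x v))"
  using assms
proof induction
  case (const c)
  show ?case by (rule exI[of _ "\<lambda>_ _. 0"]) (auto intro: bump_algebra.const)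
next
  case (inner v)
  show ?case
    by (rule exI[of _ "\<lambda>_ w. w \<bullet> v"])
      (auto intro!: bump_algebra.const derivative_eq_intros)
next
  case (add f g)
  then obtain f' g' where "\<And>x. (f has_derivative f' x) (at x)" "\<And>x. (g has_derivative g' x) (at x)"
    "\<And>v. bump_algebra (\<lambda>x. f' x v)" "\<And>v. bump_algebra (\<lambda>x. g' x v)" by blast
  then show ?case
    by (intro exI[of _ "\<lambda>x v. f' x v + g' x v"])
      (auto intro!: bump_algebra.add has_derivative_add)
next
  case (mult f g)
  then obtain f' g' where "\<And>x. (f has_derivative f' x) (at x)" "\<And>x. (g has_derivative g' x) (at x)"
    "\<And>v. bump_algebra (\<lambda>x. f' x v)" "\<And>v. bump_algebra (\<lambda>x. g' x v)" by blast
  then show ?case using mult.hyps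
    by (intro exI[of _ "\<lambda>x v. f x * g' x v + f' x v * g x"])
      (auto intro!: bump_algebra.add bump_algebra.mult has_derivative_mult)
next
  case (bump m r c)
  let ?q = "\<lambda>x. r\<^sup>2 - (x - c) \<bullet> (x - c)"
  \<comment> \<open>Built from sums, products and constants, so that the introduction rules of
    \<open>bump_algebra\<close> apply directly.\<close>
  let ?d = "\<lambda>x v. (flat_exp (m + 2) (?q x) + (- real m) * flat_exp (m + 1) (?q x)) *
    ((-2) * (x \<bullet> v + - (c \<bullet> v)))"
  have "((\<lambda>x. flat_exp m (?q x)) has_derivative ?d x) (at x)" for x
  proof -
    have "(?q has_derivative (\<lambda>v. (-2) * (x \<bullet> v + - (c \<bullet> v)))) (at x)"
      by (auto intro!: derivative_eq_intros simp: algebra_simps inner_commute)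
    from has_derivative_compose[OF this
        has_real_derivative_flat_exp[unfolded has_field_derivative_def]]
    show ?thesis by (simp add: algebra_simps)
  qed
  moreover have "bump_algebra (\<lambda>x. ?d x v)" for v
    by (intro bump_algebra.intros)
  ultimately show ?case by (intro exI[of _ ?d]) blast
qed

text \<open>Uniqueness of the derivative transfers the existential statement to
  \<open>frechet_derivative\<close>, the operator in which
  \<open>continuously_differentiable\<close> and \<open>divergence\<close> are defined.\<close>

lemma bump_algebra_frechet:
  assumes "bump_algebra f"
  shows "(f has_derivative frechet_derivative f (at x)) (at x)"
    and "bump_algebra (\<lambda>x. frechet_derivative f (at x) v)"
proof -
  obtain f' where f': "\<And>x. (f has_derivative f' x) (at x)" "\<And>v. bump_algebra (\<lambda>x. f' x v)"
    using bump_algebra_has_derivative[OF assms] by blast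
  then have "frechet_derivative f (at x) = f' x" for x
    by (metis frechet_derivative_at)
  with f' show "(f has_derivative frechet_derivative f (at x)) (at x)"
    "bump_algebra (\<lambda>x. frechet_derivative f (at x) v)" by simp_all
qed

lemma bump_algebra_continuous:
  assumes "bump_algebra f" shows "continuous_on UNIV f"
  using bump_algebra_frechet(1)[OF assms]
  by (meson continuous_at_imp_continuous_on has_derivative_continuous)

text \<open>Testing the perimeter along a path of translates requires that translates remain in the
  algebra.\<close>

lemma bump_algebra_translate:
  assumes "bump_algebra f" shows "bump_algebra (\<lambda>x. f (x + a))"
  using assms
proof induction
  case (inner v)
  show ?case unfolding inner_add_left by (intro bump_algebra.intros)
next
  case (bump m r c)
  have "x + a - c = x - (c - a)" for x by simp
  then show ?case by (simp only: bump_algebra.bump)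
qed (auto intro: bump_algebra.intros)

lemma bump_algebra_prod:
  assumes "\<And>i. i \<in> I \<Longrightarrow> bump_algebra (f i)"
  shows "bump_algebra (\<lambda>x. \<Prod>i\<in>I. f i x)"
  using assms
  by (induction I rule: infinite_finite_induct) (auto intro: bump_algebra.intros)

lemma bump_algebra_power:
  assumes "bump_algebra f" shows "bump_algebra (\<lambda>x. f x ^ n)"
  by (induction n) (auto intro: bump_algebra.intros assms)

section \<open>Test fields of constant direction\<close>

lemma has_derivative_scaleR_bump:
  assumes "bump_algebra f"
  shows "((\<lambda>x. f x *\<^sub>R w) has_derivative (\<lambda>v. frechet_derivative f (at x) v *\<^sub>R w)) (at x)"
  by (rule has_derivative_scaleR_left[OF bump_algebra_frechet(1)[OF assms]])

lemma frechet_derivative_scaleR_bump: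
  assumes "bump_algebra f"
  shows "frechet_derivative (\<lambda>x. f x *\<^sub>R w) (at x) = (\<lambda>v. frechet_derivative f (at x) v *\<^sub>R w)"
  using has_derivative_scaleR_bump[OF assms] by (rule frechet_derivative_at[symmetric])

text \<open>The induction generalises over \<open>f\<close>, since differentiating \<open>f\<close>
  times \<open>w\<close> gives another member of the algebra times the same
  \<open>w\<close>.\<close>

lemma continuously_differentiable_scaleR_bump:
  assumes "bump_algebra f"
  shows "continuously_differentiable k (\<lambda>x. f x *\<^sub>R w)"
  using assms
proof (induction k arbitrary: f)
  case 0
  then show ?case by (auto intro!: continuous_intros bump_algebra_continuous)
next
  case (Suc k)
  have "(\<lambda>x. f x *\<^sub>R w) differentiable (at x)" for x
    using has_derivative_scaleR_bump[OF Suc.prems] by (rule differentiableI)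
  moreover have "continuously_differentiable k
      (\<lambda>x. frechet_derivative (\<lambda>x. f x *\<^sub>R w) (at x) v)" for v
    unfolding frechet_derivative_scaleR_bump[OF Suc.prems]
    by (intro Suc.IH bump_algebra_frechet Suc.prems)
  ultimately show ?case by simp
qed

text \<open>Fields of one fixed direction suffice later, because translation by \<open>h\<close>
  involves derivatives along \<open>h\<close> only.\<close>

lemma scaleR_bump_in_test_fields:
  assumes "bump_algebra f" and "\<And>x. norm x > R \<Longrightarrow> f x = 0"
  shows "(\<lambda>x. f x *\<^sub>R w) \<in> test_fields"
proof -
  have "closure {x. f x *\<^sub>R w \<noteq> 0} \<subseteq> cball 0 R"
    by (rule closure_minimal) (use assms(2) in \<open>auto simp: not_less[symmetric]\<close>)
  then have "compact (closure {x. f x *\<^sub>R w \<noteq> 0})"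
    using compact_eq_bounded_closed bounded_subset bounded_cball by blast
  then show ?thesis
    using continuously_differentiable_scaleR_bump[OF assms(1), of _ w] by (auto simp: test_fields_def)
qed

text \<open>Expanding \<open>w\<close> in the basis collapses the divergence to a single directional
  derivative, by linearity.\<close>

lemma divergence_scaleR_bump:
  assumes "bump_algebra f"
  shows "divergence (\<lambda>x. f x *\<^sub>R w) x = frechet_derivative f (at x) w"
proof -
  interpret linear "frechet_derivative f (at x)"
    using bump_algebra_frechet(1)[OF assms] by (rule has_derivative_linear)
  have "frechet_derivative f (at x) w = frechet_derivative f (at x) (\<Sum>b\<in>Basis. (w \<bullet> b) *\<^sub>R b)"
    by (simp add: euclidean_representation)
  also have "\<dots> = divergence (\<lambda>x. f x *\<^sub>R w) x"
    by (simp add: divergence_def frechet_derivative_scaleR_bump[OF assms] sum scale mult.commute)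
  finally show ?thesis by simp
qed

section \<open>Sets of finite perimeter and translations\<close>

lemma borel_measurable_bump_algebra:
  "bump_algebra f \<Longrightarrow> f \<in> borel_measurable borel"
  by (intro borel_measurable_continuous_onI bump_algebra_continuous)

text \<open>Testing the total variation with \<open>f\<close> times \<open>u\<close> gives the
  bound. It is uniform in the bump, its support and the direction, which is what integration along a
  line needs.\<close>

lemma finite_perimeterE:
  fixes E :: "'a::euclidean_space set"
  assumes "finite_perimeter E" and E: "E \<in> sets borel"
  obtains V where "0 \<le> V"
    and "\<And>(f :: 'a \<Rightarrow> real) R u. \<lbrakk>bump_algebra f; \<And>x. norm x > R \<Longrightarrow> f x = 0;
           \<And>x. \<bar>f x\<bar> \<le> 1; norm u = 1\<rbrakk> \<Longrightarrow>
         - V \<le> (\<integral>x. indicat_real E x * frechet_derivative f (at x) u \<partial>lborel)"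
proof -
  let ?T = "distributional_gradient (indicat_real E)"
  obtain V where V: "total_variation ?T \<le> ereal V"
    using assms(1) unfolding finite_perimeter_def
    by (cases "total_variation ?T") auto
  show thesis
  proof (rule that[of "\<bar>V\<bar>"])
    fix f :: "'a \<Rightarrow> real" and R and u :: 'a
    assume f: "bump_algebra f" and R: "\<And>x. norm x > R \<Longrightarrow> f x = 0"
      and bound: "\<And>x. \<bar>f x\<bar> \<le> 1" and u: "norm u = 1"
    let ?\<phi> = "\<lambda>x. f x *\<^sub>R u"
    have "?\<phi> \<in> test_fields" using f R by (rule scaleR_bump_in_test_fields)
    moreover have "norm (?\<phi> x) \<le> 1" for x using bound[of x] u by simp
    ultimately have "ereal (?T ?\<phi>) \<le> total_variation ?T"
      unfolding total_variation_def by (intro SUP_upper) auto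
    then have "?T ?\<phi> \<le> V" using V by (metis ereal_less_eq(3) order_trans)
    moreover have "?T ?\<phi> = - (\<integral>x. indicat_real E x * frechet_derivative f (at x) u \<partial>lborel)"
      unfolding distributional_gradient_def divergence_scaleR_bump[OF f]
      using E borel_measurable_bump_algebra[OF bump_algebra_frechet(2)[OF f]]
      by (subst integral_completion) auto
    ultimately show "- \<bar>V\<bar> \<le> (\<integral>x. indicat_real E x * frechet_derivative f (at x) u \<partial>lborel)"
      by linarith
  qed simp
qed

section \<open>Derivatives of integrals over translates\<close>

lemma frechet_derivative_translate:
  assumes "bump_algebra f"
  shows "frechet_derivative (\<lambda>x. f (x + a)) (at x) = frechet_derivative f (at (x + a))"
proof -
  have "((\<lambda>x. x + a) has_derivative (\<lambda>v. v)) (at x)"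
    by (auto intro!: derivative_eq_intros)
  from has_derivative_compose[OF this bump_algebra_frechet(1)[OF assms]]
  show ?thesis by (rule frechet_derivative_at[symmetric])
qed

text \<open>Continuity bounds the derivative on the compact ball, and outside it \<open>f\<close>
  vanishes on an open set. The bound yields the dominating function for differentiation under the
  integral.\<close>

lemma directional_derivative_bounded:
  assumes f: "bump_algebra f" and R: "\<And>x. norm x > R \<Longrightarrow> f x = 0"
  obtains L where "\<And>x. \<bar>frechet_derivative f (at x) u\<bar> \<le> L"
proof -
  let ?D = "\<lambda>x. frechet_derivative f (at x) u"
  have "continuous_on (cball 0 R) ?D"
    using bump_algebra_continuous[OF bump_algebra_frechet(2)[OF f]] continuous_on_subset by blast
  then have "bounded (?D ` cball 0 R)"
    by (intro compact_imp_bounded compact_continuous_image) auto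
  then obtain L where L: "\<And>x. norm x \<le> R \<Longrightarrow> \<bar>?D x\<bar> \<le> L"
    unfolding bounded_iff by (metis imageI mem_cball_0 real_norm_def)
  have "?D x = 0" if "norm x > R" for x
  proof -
    have "open {x::'a. norm x > R}" by (intro open_Collect_less continuous_intros)
    then have "(f has_derivative (\<lambda>_. 0)) (at x)"
      by (rule has_derivative_transform_within_open[OF has_derivative_const[of 0]])
        (use R that in auto)
    then show ?thesis by (metis frechet_derivative_at)
  qed
  \<comment> \<open>The absolute value covers R < 0, where the ball is empty and \<open>L\<close>
    may be negative.\<close>
  then have "\<bar>?D x\<bar> \<le> \<bar>L\<bar>" for x
    using L[of x] by (cases "norm x \<le> R") auto
  then show thesis by (rule that)
qed

lemma bump_line_derivative:
  assumes "bump_algebra f"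
  shows "((\<lambda>t. f (x + t *\<^sub>R u)) has_real_derivative
    frechet_derivative f (at (x + t *\<^sub>R u)) u) (at t)"
proof -
  interpret linear "frechet_derivative f (at (x + t *\<^sub>R u))"
    using bump_algebra_frechet(1)[OF assms] by (rule has_derivative_linear)
  have "((\<lambda>t. x + t *\<^sub>R u) has_derivative (\<lambda>s. s *\<^sub>R u)) (at t)"
    by (auto intro!: derivative_eq_intros)
  from has_derivative_compose[OF this bump_algebra_frechet(1)[OF assms]]
  show ?thesis by (simp add: has_field_derivative_def scale mult_commute_abs)
qed

text \<open>The mean value inequality bounds the difference quotients by \<open>L\<close>, and
  \<open>L\<close> times the indicator is integrable because \<open>E\<close> has finite
  measure.\<close>

lemma has_real_derivative_integral_translate:
  fixes f :: "'a::euclidean_space \<Rightarrow> real"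
  assumes E[measurable]: "E \<in> sets borel" and fin: "emeasure lborel E < \<infinity>"
    and f: "bump_algebra f" and R: "\<And>x. norm x > R \<Longrightarrow> f x = 0" and le1: "\<And>x. \<bar>f x\<bar> \<le> 1"
  shows "((\<lambda>t. \<integral>x. indicat_real E x * f (x + t *\<^sub>R u) \<partial>lborel) has_real_derivative
    (\<integral>x. indicat_real E x * frechet_derivative f (at (x + t *\<^sub>R u)) u \<partial>lborel)) (at t)"
proof -
  let ?D = "\<lambda>x. frechet_derivative f (at x) u"
  obtain L where L: "\<And>x. \<bar>?D x\<bar> \<le> L"
    using directional_derivative_bounded[OF f R] by metis
  have [measurable]: "f \<in> borel_measurable borel" "?D \<in> borel_measurable borel"
    using f bump_algebra_frechet(2)[OF f] by (auto intro: borel_measurable_bump_algebra)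
  have intE: "integrable lborel (indicat_real E)"
    using fin by (simp add: integrable_indicator_iff)
  have intf: "integrable lborel (\<lambda>x. indicat_real E x * f (x + s *\<^sub>R u))" for s
    by (rule Bochner_Integration.integrable_bound[OF intE]) (auto simp: indicator_def le1)
  show ?thesis
    \<comment> \<open>Passing to arbitrary null sequences of nonzero terms makes dominated
      convergence applicable.\<close>
    unfolding DERIV_def tendsto_at_iff_sequentially comp_def
  proof safe
    fix h :: "nat \<Rightarrow> real"
    assume h: "\<forall>i. h i \<in> UNIV - {0}" and h0: "h \<longlonglongrightarrow> 0"
    have "(\<lambda>n. \<integral>x. indicat_real E x * ((f (x + (t + h n) *\<^sub>R u) - f (x + t *\<^sub>R u)) / h n) \<partial>lborel)
        \<longlonglongrightarrow> (\<integral>x. indicat_real E x * ?D (x + t *\<^sub>R u) \<partial>lborel)"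
    proof (rule integral_dominated_convergence[where w = "\<lambda>x. L * indicat_real E x"])
      show "AE x in lborel. (\<lambda>n. indicat_real E x * ((f (x + (t + h n) *\<^sub>R u) - f (x + t *\<^sub>R u)) / h n))
          \<longlonglongrightarrow> indicat_real E x * ?D (x + t *\<^sub>R u)"
      proof (intro AE_I2 tendsto_mult_left)
        fix x :: 'a
        have "((\<lambda>s. (f (x + (t + s) *\<^sub>R u) - f (x + t *\<^sub>R u)) / s) \<longlongrightarrow> ?D (x + t *\<^sub>R u)) (at 0)"
          using bump_line_derivative[OF f, of x u t] unfolding DERIV_def .
        then show "(\<lambda>n. (f (x + (t + h n) *\<^sub>R u) - f (x + t *\<^sub>R u)) / h n)
            \<longlonglongrightarrow> ?D (x + t *\<^sub>R u)"
          using h h0 unfolding tendsto_at_iff_sequentially comp_def by blast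
      qed
      fix n
      have "\<bar>f (x + (t + h n) *\<^sub>R u) - f (x + t *\<^sub>R u)\<bar> \<le> L * \<bar>h n\<bar>" for x
        using field_differentiable_bound[of UNIV "\<lambda>t. f (x + t *\<^sub>R u)" "\<lambda>t. ?D (x + t *\<^sub>R u)" L "t + h n" t]
          bump_line_derivative[OF f] L by auto
      then show "AE x in lborel. norm (indicat_real E x *
          ((f (x + (t + h n) *\<^sub>R u) - f (x + t *\<^sub>R u)) / h n)) \<le> L * indicat_real E x"
        using h by (auto simp: indicator_def divide_simps)
    qed (use intE in auto)
    moreover have "(\<integral>x. indicat_real E x * ((f (x + (t + h n) *\<^sub>R u) - f (x + t *\<^sub>R u)) / h n) \<partial>lborel)
      = ((\<integral>x. indicat_real E x * f (x + (t + h n) *\<^sub>R u) \<partial>lborel) -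
         (\<integral>x. indicat_real E x * f (x + t *\<^sub>R u) \<partial>lborel)) / h n" for n
      using intf by (simp add: right_diff_distrib diff_divide_distrib)
    ultimately show "(\<lambda>n. ((\<integral>x. indicat_real E x * f (x + (t + h n) *\<^sub>R u) \<partial>lborel) -
         (\<integral>x. indicat_real E x * f (x + t *\<^sub>R u) \<partial>lborel)) / h n)
        \<longlonglongrightarrow> (\<integral>x. indicat_real E x * ?D (x + t *\<^sub>R u) \<partial>lborel)"
      by (simp only:)
  qed
qed

text \<open>As \<open>f\<close> slides along the direction of \<open>h\<close>, its integral over
  \<open>E\<close> has derivative at least \<open>- V\<close>, so over a path of length
  \<open>norm h\<close> it drops by at most \<open>V * norm h\<close>. The constant does not depend
  on \<open>f\<close>, so limits of bumps inherit the bound.\<close>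

lemma bump_translation_bound:
  fixes E :: "'a::euclidean_space set"
  assumes "finite_perimeter E" and E[measurable]: "E \<in> sets borel" and fin: "emeasure lborel E < \<infinity>"
  obtains V where "0 \<le> V"
    and "\<And>(f :: 'a \<Rightarrow> real) R h. \<lbrakk>bump_algebra f; \<And>x. norm x > R \<Longrightarrow> f x = 0; \<And>x. \<bar>f x\<bar> \<le> 1\<rbrakk> \<Longrightarrow>
      (\<integral>x. (indicat_real E x - indicat_real E (x - h)) * f x \<partial>lborel) \<le> V * norm h"
proof -
  obtain V where "0 \<le> V" and V: "\<And>(f :: 'a \<Rightarrow> real) R u. \<lbrakk>bump_algebra f;
      \<And>x. norm x > R \<Longrightarrow> f x = 0; \<And>x. \<bar>f x\<bar> \<le> 1; norm u = 1\<rbrakk> \<Longrightarrow>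
         - V \<le> (\<integral>x. indicat_real E x * frechet_derivative f (at x) u \<partial>lborel)"
    using finite_perimeterE[OF assms(1,2)] by blast
  show thesis
  proof (rule that[OF \<open>0 \<le> V\<close>])
    fix f :: "'a \<Rightarrow> real" and R h
    assume f: "bump_algebra f" and R: "\<And>x. norm x > R \<Longrightarrow> f x = 0" and le1: "\<And>x. \<bar>f x\<bar> \<le> 1"
    have [measurable]: "f \<in> borel_measurable borel"
      using f by (rule borel_measurable_bump_algebra)
    have intE: "integrable lborel (indicat_real E)"
      using fin by (simp add: integrable_indicator_iff)
    have intf: "integrable lborel (\<lambda>x. indicat_real E x * f (x + y))" for y
      by (rule Bochner_Integration.integrable_bound[OF intE]) (auto simp: indicator_def le1)
    let ?F = "\<lambda>u t. \<integral>x. indicat_real E x * f (x + t *\<^sub>R u) \<partial>lborel"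
    have "?F u 0 + V * 0 \<le> ?F u t + V * t" if u: "norm u = 1" and "0 \<le> t" for u t
    proof (rule DERIV_nonneg_imp_nondecreasing[OF \<open>0 \<le> t\<close>])
      fix s
      let ?d = "\<integral>x. indicat_real E x * frechet_derivative f (at (x + s *\<^sub>R u)) u \<partial>lborel"
      have "((\<lambda>s. ?F u s + V * s) has_real_derivative ?d + V) (at s)"
        by (auto intro!: derivative_eq_intros
            has_real_derivative_integral_translate[OF E fin f R le1])
      moreover have "0 \<le> ?d + V"
      proof -
        \<comment> \<open>The translate vanishes outside a ball enlarged by the shift, so it is an
          admissible test function.\<close>
        have "f (x + s *\<^sub>R u) = 0" if "norm x > R + norm (s *\<^sub>R u)" for x
          using that norm_triangle_ineq4[of "x + s *\<^sub>R u" "s *\<^sub>R u"] by (intro R) auto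
        from V[of "\<lambda>x. f (x + s *\<^sub>R u)", OF bump_algebra_translate[OF f] this le1 u]
        have "- V \<le> (\<integral>x. indicat_real E x * frechet_derivative (\<lambda>x. f (x + s *\<^sub>R u)) (at x) u \<partial>lborel)"
          by blast
        then show ?thesis by (simp add: frechet_derivative_translate[OF f])
      qed
      ultimately show "\<exists>y. ((\<lambda>s. ?F u s + V * s) has_real_derivative y) (at s) \<and> 0 \<le> y" by blast
    qed
    \<comment> \<open>\<open>sgn h\<close> is a unit vector only for nonzero \<open>h\<close>; for
      \<open>h = 0\<close> the two integrals coincide.\<close>
    from this[of "sgn h" "norm h"]
    have *: "(\<integral>x. indicat_real E x * f x \<partial>lborel) - (\<integral>x. indicat_real E x * f (x + h) \<partial>lborel) \<le> V * norm h"
      by (cases "h = 0") (auto simp: norm_sgn sgn_div_norm \<open>0 \<le> V\<close>)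
    have shift: "integrable lborel (\<lambda>x. indicat_real E (x - h) * f x)"
      "(\<integral>x. indicat_real E (x - h) * f x \<partial>lborel) = (\<integral>x. indicat_real E x * f (x + h) \<partial>lborel)"
      using intf[of h]
       by (subst lborel_distr_plus[of h, symmetric],
          simp add: integrable_distr_eq integral_distr add.commute)+
    have "(\<integral>x. (indicat_real E x - indicat_real E (x - h)) * f x \<partial>lborel) =
      (\<integral>x. indicat_real E x * f x \<partial>lborel) - (\<integral>x. indicat_real E (x - h) * f x \<partial>lborel)"
      using intf[of 0] shift(1) by (simp add: left_diff_distrib)
    with * shift(2)
    show "(\<integral>x. (indicat_real E x - indicat_real E (x - h)) * f x \<partial>lborel) \<le> V * norm h" by simp
  qed
qed

section \<open>Indicators of open sets as limits of bumps\<close>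

lemma open_eq_Union_balls:
  fixes U :: "'a::euclidean_space set"
  assumes "open U"
  obtains c :: "nat \<Rightarrow> 'a" and r :: "nat \<Rightarrow> real" where "\<And>i. 0 \<le> r i" "U = (\<Union>i. ball (c i) (r i))"
proof -
  let ?F = "{ball c r | c r. 0 \<le> r \<and> ball c r \<subseteq> U}"
  obtain F' where F': "F' \<subseteq> ?F" "countable F'" "\<Union>F' = \<Union>?F"
    using Lindelof[of ?F] by blast
  have "\<Union>?F = U"
  proof
    show "U \<subseteq> \<Union>?F"
    proof
      fix x assume "x \<in> U"
      then obtain e where "e > 0" "ball x e \<subseteq> U"
        using assms open_contains_ball by blast
      then have "ball x e \<in> ?F" "x \<in> ball x e"
        by (auto intro!: exI[of _ x] exI[of _ e])
      then show "x \<in> \<Union>?F" by blast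
    qed
  qed auto
  \<comment> \<open>The empty ball makes the family nonempty, as \<open>from_nat_into\<close>
    requires, and leaves the union unchanged.\<close>
  let ?G = "insert (ball 0 0) F'"
  have "\<exists>c r. from_nat_into ?G i = ball c r \<and> 0 \<le> r" for i
  proof -
    have "from_nat_into ?G i \<in> ?G" by (rule from_nat_into) simp
    then show ?thesis using F'(1) by blast
  qed
  then obtain c r where cr: "\<And>i. from_nat_into ?G i = ball (c i) (r i)" "\<And>i. 0 \<le> r i"
    by metis
  have "U = \<Union>?G" using F'(3) \<open>\<Union>?F = U\<close> by simp
  also have "\<dots> = (\<Union>i. ball (c i) (r i))"
    using range_from_nat_into[of ?G] F'(2) cr(1) by (metis (no_types, lifting) SUP_cong countable_insert insert_not_empty)
  finally show thesis using that cr(2) by blast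
qed

text \<open>Let \<open>b i\<close> be a bump positive exactly on the i-th ball of a countable union
  equal to \<open>U\<close>. Then 1 minus the product of (1 - b i)^n over i < n lies in [0, 1] and
  has bounded support. It tends to 1 at a point where some \<open>b i\<close> is positive, and is 0
  off \<open>U\<close>.\<close>

lemma open_indicator_bump_limit:
  fixes U :: "'a::euclidean_space set"
  assumes "open U"
  obtains f :: "nat \<Rightarrow> 'a \<Rightarrow> real" and R where "\<And>n. bump_algebra (f n)"
    "\<And>n x. norm x > R n \<Longrightarrow> f n x = 0" "\<And>n x. \<bar>f n x\<bar> \<le> 1" "\<And>x. (\<lambda>n. f n x) \<longlonglongrightarrow> indicat_real U x"
proof -
  obtain c and r where r: "\<And>i. 0 \<le> r i" and U: "U = (\<Union>i::nat. ball (c i) (r i))"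
    using open_eq_Union_balls[OF assms] by metis
  define b where "b i x = flat_exp 0 ((r i)\<^sup>2 - (x - c i) \<bullet> (x - c i))" for i x
  \<comment> \<open>Writing 1 + (-1) * ... avoids subtraction, for which \<open>bump_algebra\<close>
    has no rule.\<close>
  define f where "f n x = 1 + (-1) * (\<Prod>i<n. (1 + (-1) * b i x) ^ n)" for n x
  have b01: "0 \<le> b i x" "b i x \<le> 1" for i x
    by (simp_all add: b_def flat_exp_0_bounds)
  have b_pos: "b i x \<noteq> 0 \<longleftrightarrow> x \<in> ball (c i) (r i)" for i x
  proof -
    have "b i x \<noteq> 0 \<longleftrightarrow> (norm (x - c i))\<^sup>2 < (r i)\<^sup>2"
      using flat_exp_0_bounds(1,3)[of "(r i)\<^sup>2 - (x - c i) \<bullet> (x - c i)"]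
      by (auto simp: b_def power2_norm_eq_inner)
    also have "\<dots> \<longleftrightarrow> norm (x - c i) < r i"
      using r[of i] by (metis norm_ge_zero power2_less_imp_less power_strict_mono zero_less_numeral)
    finally show ?thesis by (simp add: dist_norm norm_minus_commute)
  qed
  have prod01: "0 \<le> (\<Prod>i<n. (1 + (-1) * b i x) ^ n)" "(\<Prod>i<n. (1 + (-1) * b i x) ^ n) \<le> 1" for n x
    using b01 by (auto intro!: prod_nonneg prod_le_1 power_le_one)
  show thesis
  proof (rule that)
    show "bump_algebra (f n)" for n
      unfolding f_def b_def
      by (intro bump_algebra.intros bump_algebra_prod bump_algebra_power)
    \<comment> \<open>The sum dominates each single term, hence this radius encloses all of the
      first \<open>n\<close> balls.\<close>
    show "f n x = 0" if "norm x > (\<Sum>i<n. norm (c i) + r i)" for n x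
    proof -
      have "b i x = 0" if "i < n" for i
      proof -
        have "norm (c i) + r i \<le> (\<Sum>i<n. norm (c i) + r i)"
          using that r by (intro member_le_sum) auto
        with \<open>norm x > _\<close> have "norm (c i) + r i < norm x" by linarith
        then have "x \<notin> ball (c i) (r i)"
          using norm_triangle_ineq2[of x "c i"] by (simp add: dist_norm norm_minus_commute)
        then show ?thesis using b_pos by blast
      qed
      then show ?thesis by (simp add: f_def)
    qed
    show "\<bar>f n x\<bar> \<le> 1" for n x
      using prod01[where n = n and x = x] by (simp add: f_def)
    show "(\<lambda>n. f n x) \<longlonglongrightarrow> indicat_real U x" for x
    proof (cases "x \<in> U")
      case False
      then have "b i x = 0" for i using b_pos U by blast
      then show ?thesis using False by (simp add: f_def)
    next
      case True
      then obtain j where "b j x \<noteq> 0" using b_pos U by blast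
      then have j: "0 < b j x" using b01[of j x] by simp
      have "(\<lambda>n. \<Prod>i<n. (1 + (-1) * b i x) ^ n) \<longlonglongrightarrow> 0"
      proof (rule tendsto_sandwich[where f = "\<lambda>_. 0" and h = "\<lambda>n. (1 - b j x) ^ n"])
        show "(\<lambda>n. (1 - b j x) ^ n) \<longlonglongrightarrow> 0"
          using j b01(2)[of j x] by (intro LIMSEQ_realpow_zero) auto
        \<comment> \<open>Once \<open>n > j\<close>, the factor with index \<open>j\<close> alone
          bounds the product, since the others are at most 1.\<close>
        have "(\<Prod>i<n. (1 + (-1) * b i x) ^ n) \<le> (1 - b j x) ^ n" if "j < n" for n
        proof -
          have "(\<Prod>i<n. (1 + (-1) * b i x) ^ n) =
              (1 + (-1) * b j x) ^ n * (\<Prod>i\<in>{..<n} - {j}. (1 + (-1) * b i x) ^ n)"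
            using that by (intro prod.remove) auto
          also have "\<dots> \<le> (1 + (-1) * b j x) ^ n * 1"
            using b01 by (intro mult_left_mono prod_le_1) (auto intro!: power_le_one)
          finally show ?thesis by simp
        qed
        then show "\<forall>\<^sub>F n in sequentially. (\<Prod>i<n. (1 + (-1) * b i x) ^ n) \<le> (1 - b j x) ^ n"
          by (rule eventually_mono[OF eventually_gt_at_top[of j]])
      qed (use prod01 in auto)
      then have "(\<lambda>n. f n x) \<longlonglongrightarrow> 1 + (-1) * 0"
        unfolding f_def by (intro tendsto_intros)
      then show ?thesis using True by simp
    qed
  qed
qed

text \<open>The part of \<open>E\<close> outside \<open>E + h\<close>. For finite measure, its size
  is |E| minus the covariogram of \<open>E\<close> at \<open>h\<close>; this is the g(h) of the
  overview.\<close>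

definition displaced :: "'a::ab_group_add set \<Rightarrow> 'a \<Rightarrow> 'a set" where
  "displaced E h = {x \<in> E. x - h \<notin> E}"

lemma displaced_measurable [measurable]:
  fixes E :: "'a::euclidean_space set"
  assumes [measurable]: "E \<in> sets borel" shows "displaced E h \<in> sets borel"
proof -
  have "displaced E h = E - (\<lambda>x. x - h) -` E" by (auto simp: displaced_def)
  moreover have "(\<lambda>x. x - h) -` E \<inter> space borel \<in> sets borel" by measurable
  ultimately show ?thesis by auto
qed

text \<open>Bumps approximate the indicator of an open set, and open sets approximate the displaced
  set from outside. The bound \<open>V * norm h\<close> survives both limits.\<close>

lemma displaced_measure_le:
  fixes E :: "'a::euclidean_space set"
  assumes "finite_perimeter E" and E[measurable]: "E \<in> sets borel" and fin: "emeasure lborel E < \<infinity>"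
  obtains V where "0 \<le> V" "\<And>h. measure lborel (displaced E h) \<le> V * norm h"
proof -
  obtain V where "0 \<le> V" and V: "\<And>(f :: 'a \<Rightarrow> real) R h. \<lbrakk>bump_algebra f;
      \<And>x. norm x > R \<Longrightarrow> f x = 0; \<And>x. \<bar>f x\<bar> \<le> 1\<rbrakk> \<Longrightarrow>
      (\<integral>x. (indicat_real E x - indicat_real E (x - h)) * f x \<partial>lborel) \<le> V * norm h"
    using bump_translation_bound[OF assms] by blast
  have "measure lborel (displaced E h) \<le> V * norm h" for h
  proof -
    let ?d = "\<lambda>x. indicat_real E x - indicat_real E (x - h)"
    have "integrable lborel (indicat_real E)"
      using fin by (simp add: integrable_indicator_iff)
    moreover from this have "integrable lborel (\<lambda>x. indicat_real E (x - h))"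
      by (subst lborel_distr_plus[of h, symmetric], subst integrable_distr_eq) auto
    ultimately have intd: "integrable lborel ?d" by simp
    have open_le: "(\<integral>x. ?d x * indicat_real U x \<partial>lborel) \<le> V * norm h" if "open U" for U
    proof -
      obtain f R where f: "\<And>n. bump_algebra (f n)" "\<And>n x. norm x > R n \<Longrightarrow> f n x = 0"
        "\<And>n x. \<bar>f n x\<bar> \<le> 1" "\<And>x. (\<lambda>n. f n x) \<longlonglongrightarrow> indicat_real U x"
        using open_indicator_bump_limit[OF \<open>open U\<close>] by metis
      have [measurable]: "U \<in> sets borel" using that by simp
      have [measurable]: "f n \<in> borel_measurable borel" for n
        using f(1) by (rule borel_measurable_bump_algebra)
      have "(\<lambda>n. \<integral>x. ?d x * f n x \<partial>lborel) \<longlonglongrightarrow> (\<integral>x. ?d x * indicat_real U x \<partial>lborel)"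
      proof (rule integral_dominated_convergence[where w = "\<lambda>x. \<bar>?d x\<bar>"])
        show "integrable lborel (\<lambda>x. \<bar>?d x\<bar>)" using intd by simp
        show "AE x in lborel. norm (?d x * f n x) \<le> \<bar>?d x\<bar>" for n
          using f(3) by (auto simp: abs_mult mult_left_le)
      qed (auto intro!: tendsto_intros f(4))
      then show ?thesis
        by (rule LIMSEQ_le_const2) (use V[OF f(1-3)] in blast)
    qed
    \<comment> \<open>Testing against open sets close to \<open>displaced E h\<close>, on which the difference \<open>?d\<close> equals 1.\<close>
    let ?A = "displaced E h"
    show ?thesis
    proof (rule field_le_epsilon)
      fix e :: real assume "0 < e"
      have "?A \<in> sets lebesgue" by simp
      then obtain U where U: "open U" "?A \<subseteq> U" "emeasure lebesgue (U - ?A) < ennreal e"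
        using sets_lebesgue_outer_open[OF _ \<open>0 < e\<close>] by metis
      have [measurable]: "U \<in> sets borel" using U(1) by simp
      have emU: "emeasure lborel (U - ?A) < ennreal e" using U(3) by simp
      have emA: "emeasure lborel ?A < \<infinity>"
        by (rule le_less_trans[OF emeasure_mono fin]) (auto simp: displaced_def)
      have int: "integrable lborel (indicat_real ?A)" "integrable lborel (indicat_real (U - ?A))"
        using emA emU by (auto simp: integrable_indicator_iff less_top[symmetric] top_unique)
      have "measure lborel ?A - measure lborel (U - ?A) =
          (\<integral>x. indicat_real ?A x - indicat_real (U - ?A) x \<partial>lborel)"
        using int by simp
      \<comment> \<open>On \<open>U - ?A\<close> the difference \<open>?d\<close> is at least -1,
        which the subtracted indicator absorbs.\<close>
      also have "\<dots> \<le> (\<integral>x. ?d x * indicat_real U x \<partial>lborel)"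
      proof (rule integral_mono)
        show "integrable lborel (\<lambda>x. ?d x * indicat_real U x)"
          using intd by (rule Bochner_Integration.integrable_bound) (auto simp: indicator_def)
        show "integrable lborel (\<lambda>x. indicat_real ?A x - indicat_real (U - ?A) x)"
          using int by simp
      qed (use U(2) in \<open>auto simp: indicator_def displaced_def\<close>)
      also have "\<dots> \<le> V * norm h" by (rule open_le[OF U(1)])
      finally have "measure lborel ?A - measure lborel (U - ?A) \<le> V * norm h" .
      moreover have "measure lborel (U - ?A) \<le> e"
        using emU \<open>0 < e\<close> by (simp add: measure_def enn2real_leI)
      ultimately show "measure lborel ?A \<le> V * norm h + e" by linarith
    qed
  qed
  with \<open>0 \<le> V\<close> show thesis by (rule that)
qed

section \<open>Kernels with slowly varying tail mass\<close>

text \<open>Controls the contribution of the origin, where \<open>J\<close> itself may fail to be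
  integrable; it pairs with the bound g(h) \<le> V |h|.\<close>

definition near_moment :: "('a::euclidean_space \<Rightarrow> real) \<Rightarrow> real \<Rightarrow> real" where
  "near_moment J s = (\<integral>x. indicator {x. norm x \<le> s} x * (norm x * J x) \<partial>lebesgue)"

lemma tail_mass_eq: "tail_mass J s = (\<integral>x. indicator {x. norm x > s} x * J x \<partial>lebesgue)"
  by (simp add: tail_mass_def set_lebesgue_integral_def)

text \<open>The assumption \<open>int\<close> is the moment condition at scale \<epsilon> = 1, where
  the rescaled kernel is \<open>J\<close>.\<close>

locale moment_kernel =
  fixes J :: "'a::euclidean_space \<Rightarrow> real"
  assumes meas [measurable]: "J \<in> borel_measurable lebesgue"
    and pos: "J x > 0"
    and int: "integrable lebesgue (\<lambda>x. min 1 (norm x) * J x)"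
begin

lemma norm_measurable [measurable]: "(norm :: 'a \<Rightarrow> real) \<in> borel_measurable lebesgue"
  by (rule measurable_completion) simp

lemma nonneg: "0 \<le> J x"
  using pos[of x] by simp

lemma integrable_by_moment:
  assumes "f \<in> borel_measurable lebesgue" and "\<And>x. \<bar>f x\<bar> \<le> C * (min 1 (norm x) * J x)"
  shows "integrable lebesgue f"
  by (rule Bochner_Integration.integrable_bound[of _ "\<lambda>x. C * (min 1 (norm x) * J x)"])
    (use assms int order_trans[OF assms(2) abs_ge_self] in auto)

lemma integrable_tail:
  assumes "s > 0"
  shows "integrable lebesgue (\<lambda>x. indicator {x. norm x > s} x * J x)"
\<comment> \<open>Beyond radius \<open>s\<close> the weight \<open>min 1 (norm x)\<close> is at
  least \<open>min 1 s\<close>.\<close>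
proof (rule integrable_by_moment[where C = "1 / min 1 s"])
  show "(\<lambda>x. indicator {x. norm x > s} x * J x) \<in> borel_measurable lebesgue" by measurable
  show "\<bar>indicator {x. norm x > s} x * J x\<bar> \<le> 1 / min 1 s * (min 1 (norm x) * J x)" for x
  proof (cases "norm x > s")
    case True
    then have "1 \<le> min 1 (norm x) / min 1 s" using assms by (simp add: divide_simps)
    from mult_right_mono[OF this nonneg[of x]] show ?thesis
      using True nonneg[of x] by simp
  qed (use assms nonneg[of x] in simp)
qed

lemma integrable_near:
  "integrable lebesgue (\<lambda>x. indicator {x. norm x \<le> s} x * (norm x * J x))"
\<comment> \<open>The factor 1 serves norm x \<le> 1, and the factor \<open>s\<close> serves 1 <
  norm x \<le> s.\<close>
proof (rule integrable_by_moment[where C = "max 1 s"])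
  show "(\<lambda>x. indicator {x. norm x \<le> s} x * (norm x * J x)) \<in> borel_measurable lebesgue" by measurable
  show "\<bar>indicator {x. norm x \<le> s} x * (norm x * J x)\<bar> \<le> max 1 s * (min 1 (norm x) * J x)" for x
  proof (cases "norm x \<le> s")
    case True
    have "norm x \<le> max 1 s * min 1 (norm x)"
    proof (cases "norm x \<le> 1")
      case True
      then show ?thesis using mult_right_mono[of 1 "max 1 s" "norm x"] by simp
    qed (use True in simp)
    from mult_right_mono[OF this nonneg[of x]] show ?thesis
      using True nonneg[of x] by (simp add: mult.assoc)
  qed (use nonneg[of x] in simp)
qed

text \<open>A positive function with zero integral would force the exterior of the ball to be null,
  but that exterior is open and nonempty. Positivity justifies dividing by the tail mass.\<close>

lemma tail_mass_pos:
  assumes "s > 0" shows "tail_mass J s > 0"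
proof -
  let ?f = "\<lambda>x. indicator {x. norm x > s} x * J x"
  have "(\<integral>x. ?f x \<partial>lebesgue) \<noteq> 0"
  proof
    assume "(\<integral>x. ?f x \<partial>lebesgue) = 0"
    then have "AE x in lebesgue. ?f x = 0"
      using integrable_tail[OF assms] nonneg by (subst (asm) integral_nonneg_eq_0_iff_AE) auto
    then have "AE x in lebesgue. x \<notin> {x::'a. norm x > s}"
      by eventually_elim (use pos in \<open>auto simp: indicator_def less_imp_neq[symmetric] split: if_splits\<close>)
    moreover have op: "open {x::'a. norm x > s}"
      by (intro open_Collect_less continuous_intros)
    ultimately have "{x::'a. norm x > s} \<in> null_sets lebesgue"
      by (subst AE_iff_null_sets) auto
    moreover obtain v :: 'a where "norm v = s + 1" using vector_choose_size[of "s + 1"] assms by auto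
    then have "{x::'a. norm x > s} \<noteq> {}" by (auto intro!: exI[of _ v])
    ultimately show False
      using open_not_negligible[OF op] by (simp add: negligible_iff_null_sets)
  qed
  moreover have "(\<integral>x. ?f x \<partial>lebesgue) \<ge> 0"
    by (rule integral_nonneg_AE) (use nonneg in auto)
  ultimately show ?thesis by (simp add: tail_mass_eq)
qed

lemma near_moment_nonneg: "0 \<le> near_moment J s"
  unfolding near_moment_def by (rule integral_nonneg_AE) (use nonneg in auto)

text \<open>On the shell s/2 < norm x \<le> s the weight is at most \<open>s\<close>, and the mass
  of the shell is the difference of the two tails.\<close>

lemma near_moment_halve:
  assumes "s > 0"
  shows "near_moment J s \<le> near_moment J (s / 2) + s * (tail_mass J (s / 2) - tail_mass J s)"
proof -
  let ?n = "\<lambda>s x. indicator {x. norm x \<le> s} x * (norm x * J x)"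
  let ?t = "\<lambda>s x. indicator {x. norm x > s} x * J x"
  have i: "integrable lebesgue (?t s)" "integrable lebesgue (?t (s / 2))"
    using integrable_tail[of s] integrable_tail[of "s / 2"] assms by simp_all
  have "near_moment J s \<le> (\<integral>x. ?n (s / 2) x + s * (?t (s / 2) x - ?t s x) \<partial>lebesgue)"
    unfolding near_moment_def
  proof (rule integral_mono)
    show "integrable lebesgue (\<lambda>x. ?n (s / 2) x + s * (?t (s / 2) x - ?t s x))"
      using i integrable_near[of "s / 2"] by simp
    show "?n s x \<le> ?n (s / 2) x + s * (?t (s / 2) x - ?t s x)" for x
      using nonneg[of x] assms mult_right_mono[of "norm x" s "J x"]
      by (auto simp: indicator_def)
  qed (rule integrable_near)
  also have "\<dots> = near_moment J (s / 2) + s * (tail_mass J (s / 2) - tail_mass J s)"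
    using i integrable_near[of "s / 2"] by (simp add: near_moment_def tail_mass_eq)
  finally show ?thesis .
qed

text \<open>Dominated convergence: at each nonzero x the integrand vanishes once s / 2^n < norm x,
  and at 0 the factor \<open>norm x\<close> is zero.\<close>

lemma near_moment_tendsto_0:
  assumes "s > 0"
  shows "(\<lambda>n. near_moment J (s / 2 ^ n)) \<longlonglongrightarrow> 0"
proof -
  let ?n = "\<lambda>s x. indicator {x. norm x \<le> s} x * (norm x * J x)"
  have "(\<lambda>n. \<integral>x. ?n (s / 2 ^ n) x \<partial>lebesgue) \<longlonglongrightarrow> (\<integral>x. 0 \<partial>(lebesgue :: 'a measure))"
  proof (rule integral_dominated_convergence[where w = "?n s"])
    show "integrable lebesgue (?n s)" by (rule integrable_near)
    show "AE x in lebesgue. norm (?n (s / 2 ^ n) x) \<le> ?n s x" for n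
    proof (rule AE_I2)
      have "s / 2 ^ n \<le> s" using assms by (simp add: divide_simps)
      then show "norm (?n (s / 2 ^ n) x) \<le> ?n s x" for x
        using nonneg[of x] by (auto simp: indicator_def)
    qed
    show "AE x in lebesgue. (\<lambda>n. ?n (s / 2 ^ n) x) \<longlonglongrightarrow> 0"
    proof (rule AE_I2)
      fix x :: 'a
      show "(\<lambda>n. ?n (s / 2 ^ n) x) \<longlonglongrightarrow> 0"
      proof (cases "x = 0")
        case False
        have "(\<lambda>n. s * (1 / 2) ^ n) \<longlonglongrightarrow> s * 0"
          by (intro tendsto_intros LIMSEQ_realpow_zero) auto
        then have "(\<lambda>n. s / 2 ^ n) \<longlonglongrightarrow> 0" by (simp add: power_divide)
        then have "\<forall>\<^sub>F n in sequentially. s / 2 ^ n < norm x"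
          by (rule order_tendstoD) (use False in simp)
        then have "\<forall>\<^sub>F n in sequentially. ?n (s / 2 ^ n) x = 0"
          by eventually_elim (auto simp: indicator_def)
        then show ?thesis by (rule tendsto_eventually)
      qed simp
    qed
  qed measurable
  then show ?thesis by (simp add: near_moment_def)
qed

text \<open>The difference of the two sides does not decrease when \<open>s\<close> is halved. Along
  s / 2^n it is at most the near moment, which tends to 0, so it is nonpositive at
  \<open>s\<close>.\<close>

lemma near_moment_le:
  assumes "0 < \<delta>" "\<delta> \<le> 1/2"
    and slow: "\<And>s. \<lbrakk>0 < s; s < b\<rbrakk> \<Longrightarrow> tail_mass J (s / 2) \<le> (1 + \<delta>) * tail_mass J s"
    and "0 < s" "s < b"
  shows "near_moment J s \<le> 4 * \<delta> * s * tail_mass J s"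
proof -
  \<comment> \<open>The constant 4 makes \<open>?p\<close> increase when \<open>s\<close> is halved: \<open>1 - 4 + 2 (1 + \<delta>) \<le> 0\<close>.\<close>
  let ?p = "\<lambda>s. near_moment J s - 4 * \<delta> * s * tail_mass J s"
  have step: "?p s \<le> ?p (s / 2)" if "0 < s" "s < b" for s
  proof -
    have t: "0 < tail_mass J s" using that by (simp add: tail_mass_pos)
    have l: "tail_mass J (s / 2) - tail_mass J s \<le> \<delta> * tail_mass J s"
      using slow[OF that] by (simp add: algebra_simps)
    have l2: "tail_mass J (s / 2) \<le> 3 / 2 * tail_mass J s"
      using slow[OF that] mult_right_mono[of "1 + \<delta>" "3/2" "tail_mass J s"] assms(2) t by linarith
    have "near_moment J s \<le> near_moment J (s / 2) + \<delta> * s * tail_mass J s"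
      using near_moment_halve[OF \<open>0 < s\<close>] mult_left_mono[OF l, of s] that by (simp add: algebra_simps)
    moreover have "2 * \<delta> * s * tail_mass J (s / 2) \<le> 3 * \<delta> * s * tail_mass J s"
      using mult_left_mono[OF l2, of "2 * \<delta> * s"] that assms(1) by simp
    ultimately show ?thesis by simp
  qed
  have "?p s \<le> near_moment J (s / 2 ^ n)" for n
  proof -
    have small: "0 < s / 2 ^ n" "s / 2 ^ n < b" for n
      using assms(4,5) by (auto simp: divide_simps intro: less_le_trans[of s b "b * 2 ^ n"])
    have "?p s \<le> ?p (s / 2 ^ n)"
    proof (induction n)
      case (Suc n)
      from step[OF small[of n]] Suc.IH show ?case by (simp add: mult.commute)
    qed simp
    moreover have "0 < tail_mass J (s / 2 ^ n)" using small(1)[of n] by (rule tail_mass_pos)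
    ultimately show ?thesis using small(1)[of n] assms(1)
      by (smt (verit) mult_pos_pos)
  qed
  then have "?p s \<le> 0"
    by (intro LIMSEQ_le_const[OF near_moment_tendsto_0[OF \<open>0 < s\<close>]]) blast
  then show ?thesis by simp
qed

text \<open>Slow variation with factor 1/2 supplies the hypothesis of \<open>near_moment_le\<close>
  for arbitrarily small \<delta>.\<close>

lemma near_moment_negligible:
  assumes "slowly_varying_at_zero (tail_mass J)"
  shows "((\<lambda>s. near_moment J s / (s * tail_mass J s)) \<longlongrightarrow> 0) (at_right 0)"
proof (rule tendstoI)
  fix e :: real assume "0 < e"
  \<comment> \<open>The choice e / 8 makes 4 \<delta> at most e / 2, hence strictly below
    \<open>e\<close>.\<close>
  define \<delta> where "\<delta> = min (1/2) (e / 8)"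
  have \<delta>: "0 < \<delta>" "\<delta> \<le> 1/2" "4 * \<delta> < e" using \<open>0 < e\<close> by (auto simp: \<delta>_def)
  have "((\<lambda>s. tail_mass J (1/2 * s) / tail_mass J s) \<longlongrightarrow> 1) (at_right 0)"
    using assms unfolding slowly_varying_at_zero_def by (elim allE[of _ "1/2"]) simp
  then have "\<forall>\<^sub>F s in at_right 0. tail_mass J (1/2 * s) / tail_mass J s < 1 + \<delta>"
    by (rule order_tendstoD) (use \<delta> in simp)
  then obtain b where b: "b > 0" "\<And>s. \<lbrakk>0 < s; s < b\<rbrakk> \<Longrightarrow> tail_mass J (1/2 * s) / tail_mass J s < 1 + \<delta>"
    unfolding eventually_at_right_field by blast
  have slow: "tail_mass J (s / 2) \<le> (1 + \<delta>) * tail_mass J s" if "0 < s" "s < b" for s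
    using b(2)[OF that] tail_mass_pos[OF that(1)] by (simp add: divide_simps split: if_splits)
  have "dist (near_moment J s / (s * tail_mass J s)) 0 < e" if "0 < s" "s < b" for s
  proof -
    have "0 < s * tail_mass J s" using that tail_mass_pos by simp
    moreover have "near_moment J s \<le> 4 * \<delta> * (s * tail_mass J s)"
      using near_moment_le[OF \<delta>(1,2) slow that] by (simp add: mult.assoc)
    ultimately have "near_moment J s / (s * tail_mass J s) \<le> 4 * \<delta>"
      by (simp add: pos_divide_le_eq)
    moreover have "0 \<le> near_moment J s / (s * tail_mass J s)"
      using near_moment_nonneg \<open>0 < s * _\<close> by simp
    ultimately show ?thesis using \<delta>(3) by simp
  qed
  then show "\<forall>\<^sub>F s in at_right 0. dist (near_moment J s / (s * tail_mass J s)) 0 < e"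
    unfolding eventually_at_right_field using b(1) by blast
qed

text \<open>From above, g \<le> m is used for norm u > \<epsilon> and the linear bound inside, where
  the near moment is negligible. From below, only norm u > R \<epsilon> is kept, and slow variation
  compares its mass with the tail at \<epsilon>.\<close>

lemma tendsto_average:
  fixes g :: "'a \<Rightarrow> real"
  assumes slow: "slowly_varying_at_zero (tail_mass J)"
    and [measurable]: "g \<in> borel_measurable borel"
    and g: "\<And>h. 0 \<le> g h" "\<And>h. g h \<le> m" "\<And>h. g h \<le> V * norm h"
    and ginf: "\<And>e. e > 0 \<Longrightarrow> \<exists>R>0. \<forall>h. norm h > R \<longrightarrow> m - e \<le> g h"
  shows "\<epsilon> > 0 \<Longrightarrow> integrable lebesgue (\<lambda>u. J u * g (u /\<^sub>R \<epsilon>))"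
    and "((\<lambda>\<epsilon>. (\<integral>u. J u * g (u /\<^sub>R \<epsilon>) \<partial>lebesgue) / tail_mass J \<epsilon>) \<longlongrightarrow> m) (at_right 0)"
proof -
  have [measurable]: "(\<lambda>u. g (u /\<^sub>R \<epsilon>)) \<in> borel_measurable lebesgue" for \<epsilon>
    by (rule measurable_completion) simp
  have "0 \<le> m" using g(1,2)[of 0] by simp
  \<comment> \<open>A unit vector exists because the dimension is at least one; evaluating the
    linear bound there forces \<open>V\<close> to be nonnegative.\<close>
  obtain v :: 'a where "norm v = 1" using vector_choose_size[of 1] by auto
  then have "0 \<le> V" using g(1,3)[of v] by simp
  show integrable: "integrable lebesgue (\<lambda>u. J u * g (u /\<^sub>R \<epsilon>))" if "\<epsilon> > 0" for \<epsilon>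
  \<comment> \<open>The summand V / \<epsilon> handles the unit ball and \<open>m\<close> its
    exterior.\<close>
  proof (rule integrable_by_moment[where C = "m + V / \<epsilon>"])
    show "\<bar>J u * g (u /\<^sub>R \<epsilon>)\<bar> \<le> (m + V / \<epsilon>) * (min 1 (norm u) * J u)" for u
    proof -
      have "g (u /\<^sub>R \<epsilon>) \<le> (m + V / \<epsilon>) * min 1 (norm u)"
      proof (cases "norm u \<le> 1")
        case True
        have "g (u /\<^sub>R \<epsilon>) \<le> V / \<epsilon> * norm u"
          using g(3)[of "u /\<^sub>R \<epsilon>"] that by (simp add: divide_inverse_commute mult_ac)
        also have "\<dots> \<le> (m + V / \<epsilon>) * norm u"
          using \<open>0 \<le> m\<close> by (intro mult_right_mono) auto
        finally show ?thesis using True by simp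
      next
        case False
        have "0 \<le> V / \<epsilon>" using \<open>0 \<le> V\<close> that by simp
        then show ?thesis using g(2)[of "u /\<^sub>R \<epsilon>"] False by simp
      qed
      from mult_right_mono[OF this nonneg[of u]] show ?thesis
        using g(1) nonneg[of u] by (simp add: mult_ac)
    qed
  qed measurable
  let ?P = "\<lambda>\<epsilon>. \<integral>u. J u * g (u /\<^sub>R \<epsilon>) \<partial>lebesgue"
  have upper: "?P \<epsilon> / tail_mass J \<epsilon> \<le> m + V * (near_moment J \<epsilon> / (\<epsilon> * tail_mass J \<epsilon>))"
    if "\<epsilon> > 0" for \<epsilon>
  proof -
    let ?n = "\<lambda>x. indicator {x. norm x \<le> \<epsilon>} x * (norm x * J x)"
    let ?t = "\<lambda>x. indicator {x. norm x > \<epsilon>} x * J x"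
    have "?P \<epsilon> \<le> (\<integral>u. m * ?t u + V / \<epsilon> * ?n u \<partial>lebesgue)"
    proof (rule integral_mono)
      show "integrable lebesgue (\<lambda>u. m * ?t u + V / \<epsilon> * ?n u)"
        using integrable_tail[OF that] integrable_near[of \<epsilon>] by simp
      show "J u * g (u /\<^sub>R \<epsilon>) \<le> m * ?t u + V / \<epsilon> * ?n u" for u
        using mult_left_mono[OF g(2) nonneg, of u "u /\<^sub>R \<epsilon>"]
          mult_left_mono[OF g(3) nonneg, of u "u /\<^sub>R \<epsilon>"] that
        by (cases "norm u \<le> \<epsilon>") (auto simp: indicator_def field_simps)
    qed (rule integrable[OF that])
    also have "\<dots> = m * tail_mass J \<epsilon> + V / \<epsilon> * near_moment J \<epsilon>"
      using integrable_tail[OF that] integrable_near[of \<epsilon>]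
      by (simp add: near_moment_def tail_mass_eq)
    finally have "?P \<epsilon> \<le> m * tail_mass J \<epsilon> + V / \<epsilon> * near_moment J \<epsilon>" .
    from divide_right_mono[OF this, of "tail_mass J \<epsilon>"]
    show ?thesis using tail_mass_pos[OF that] that by (simp add: add_divide_distrib)
  qed
  have lower: "(m - e) * (tail_mass J (R * \<epsilon>) / tail_mass J \<epsilon>) \<le> ?P \<epsilon> / tail_mass J \<epsilon>"
    if "\<epsilon> > 0" "R > 0" and R: "\<And>h. norm h > R \<Longrightarrow> m - e \<le> g h" for \<epsilon> R e
  proof -
    let ?t = "\<lambda>x. indicator {x. norm x > R * \<epsilon>} x * J x"
    have t: "integrable lebesgue ?t" using that by (intro integrable_tail) simp
    have "(m - e) * tail_mass J (R * \<epsilon>) = (\<integral>u. (m - e) * ?t u \<partial>lebesgue)"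
      using t by (simp add: tail_mass_eq)
    also have "\<dots> \<le> ?P \<epsilon>"
    proof (rule integral_mono)
      show "(m - e) * ?t u \<le> J u * g (u /\<^sub>R \<epsilon>)" for u
      proof (cases "norm u > R * \<epsilon>")
        case True
        then have "m - e \<le> g (u /\<^sub>R \<epsilon>)" using that(1) by (intro R) (simp add: field_simps)
        from mult_right_mono[OF this nonneg[of u]] show ?thesis
          using True by (simp add: mult.commute)
      qed (use g(1) nonneg[of u] in simp)
    qed (use t integrable[OF that(1)] in simp_all)
    finally have "(m - e) * tail_mass J (R * \<epsilon>) \<le> ?P \<epsilon>" .
    from divide_right_mono[OF this, of "tail_mass J \<epsilon>"]
    show ?thesis using tail_mass_pos[OF that(1)] by simp
  qed
  have ev0: "\<forall>\<^sub>F \<epsilon> in at_right 0. (0::real) < \<epsilon>" by (rule eventually_at_right_less)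
  show "((\<lambda>\<epsilon>. ?P \<epsilon> / tail_mass J \<epsilon>) \<longlongrightarrow> m) (at_right 0)"
  proof (rule order_tendstoI)
    fix a assume "a < m"
    then obtain R where "R > 0" and R: "\<And>h. norm h > R \<Longrightarrow> m - (m - a) / 2 \<le> g h"
      using ginf[of "(m - a) / 2"] by auto
    \<comment> \<open>The limit is the midpoint of \<open>a\<close> and \<open>m\<close>, which lies
      strictly above \<open>a\<close>.\<close>
    have "((\<lambda>\<epsilon>. (m - (m - a) / 2) * (tail_mass J (R * \<epsilon>) / tail_mass J \<epsilon>))
        \<longlongrightarrow> (m - (m - a) / 2) * 1) (at_right 0)"
      using slow \<open>R > 0\<close> unfolding slowly_varying_at_zero_def by (intro tendsto_mult_left) blast
    then have "\<forall>\<^sub>F \<epsilon> in at_right 0. a < (m - (m - a) / 2) * (tail_mass J (R * \<epsilon>) / tail_mass J \<epsilon>)"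
      by (rule order_tendstoD) (use \<open>a < m\<close> in \<open>simp add: field_simps\<close>)
    with ev0 show "\<forall>\<^sub>F \<epsilon> in at_right 0. a < ?P \<epsilon> / tail_mass J \<epsilon>"
      by eventually_elim (rule less_le_trans[OF _ lower[OF _ \<open>R > 0\<close> R]])
  next
    fix a assume "m < a"
    have "((\<lambda>\<epsilon>. m + V * (near_moment J \<epsilon> / (\<epsilon> * tail_mass J \<epsilon>))) \<longlongrightarrow> m + V * 0) (at_right 0)"
      by (intro tendsto_intros near_moment_negligible slow)
    then have "\<forall>\<^sub>F \<epsilon> in at_right 0. m + V * (near_moment J \<epsilon> / (\<epsilon> * tail_mass J \<epsilon>)) < a"
      by (rule order_tendstoD) (use \<open>m < a\<close> in simp)
    with ev0 show "\<forall>\<^sub>F \<epsilon> in at_right 0. ?P \<epsilon> / tail_mass J \<epsilon> < a"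
      by eventually_elim (rule le_less_trans[OF upper])
  qed
qed

end

section \<open>The nonlocal perimeter as an average\<close>

text \<open>Rewriting the map coordinatewise matches the affine change of variables for Lebesgue
  measure. It is stated for the completed measure because \<open>J\<close> is only Lebesgue
  measurable.\<close>

lemma
  fixes t :: "'a::euclidean_space"
  assumes "c \<noteq> 0"
  shows measurable_lebesgue_homothety: "(\<lambda>x. t + c *\<^sub>R x) \<in> lebesgue \<rightarrow>\<^sub>M lebesgue"
    and lebesgue_homothety: "lebesgue = density (distr lebesgue lebesgue (\<lambda>x. t + c *\<^sub>R x)) (\<lambda>_. ennreal (\<bar>c\<bar> ^ DIM('a)))"
proof -
  have T: "(\<lambda>x::'a. t + c *\<^sub>R x) = (\<lambda>x. t + (\<Sum>j\<in>Basis. (c * (x \<bullet> j)) *\<^sub>R j))"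
    by (simp add: scaleR_sum_right[symmetric] scaleR_scaleR[symmetric] euclidean_representation
        del: scaleR_scaleR)
  show "(\<lambda>x. t + c *\<^sub>R x) \<in> lebesgue \<rightarrow>\<^sub>M lebesgue"
    unfolding T by (rule lebesgue_affine_measurable) (use assms in simp)
  show "lebesgue = density (distr lebesgue lebesgue (\<lambda>x. t + c *\<^sub>R x)) (\<lambda>_. ennreal (\<bar>c\<bar> ^ DIM('a)))"
    using lebesgue_affine_euclidean[of "\<lambda>_. c" t] assms unfolding T by simp
qed

lemma nn_integral_lebesgue_homothety:
  fixes f :: "'a::euclidean_space \<Rightarrow> ennreal"
  assumes f [measurable]: "f \<in> borel_measurable lebesgue" and c: "c \<noteq> 0"
  shows "(\<integral>\<^sup>+x. f x \<partial>lebesgue) = (\<integral>\<^sup>+x. ennreal (\<bar>c\<bar> ^ DIM('a)) * f (t + c *\<^sub>R x) \<partial>lebesgue)"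
proof -
  note [measurable] = measurable_lebesgue_homothety[OF c, of t]
  have "(\<integral>\<^sup>+x. f x \<partial>lebesgue) = (\<integral>\<^sup>+x. f x \<partial>density (distr lebesgue lebesgue (\<lambda>x. t + c *\<^sub>R x))
      (\<lambda>_. ennreal (\<bar>c\<bar> ^ DIM('a))))"
    using lebesgue_homothety[OF c, of t] by (rule arg_cong2[OF _ refl, of _ _ nn_integral])
  also have "\<dots> = (\<integral>\<^sup>+x. ennreal (\<bar>c\<bar> ^ DIM('a)) * f (t + c *\<^sub>R x) \<partial>lebesgue)"
    by (subst nn_integral_density, simp_all, subst nn_integral_distr, simp_all)
  finally show ?thesis .
qed

text \<open>The product of indicators is jointly measurable in x and h, which gives measurability in
  h and the form reached after Tonelli.\<close>

lemma emeasure_displaced: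
  fixes E :: "'a::euclidean_space set"
  assumes [measurable]: "E \<in> sets borel"
  shows "emeasure lborel (displaced E h) = (\<integral>\<^sup>+x. indicator E x * indicator (- E) (x - h) \<partial>lborel)"
proof -
  have "emeasure lborel (displaced E h) = (\<integral>\<^sup>+x. indicator (displaced E h) x \<partial>lborel)" by simp
  also have "\<dots> = (\<integral>\<^sup>+x. indicator E x * indicator (- E) (x - h) \<partial>lborel)"
    by (rule nn_integral_cong) (auto simp: indicator_def displaced_def)
  finally show ?thesis .
qed

lemma borel_measurable_emeasure_displaced [measurable]:
  fixes E :: "'a::euclidean_space set"
  assumes [measurable]: "E \<in> sets borel"
  shows "(\<lambda>h. emeasure lborel (displaced E h)) \<in> borel_measurable borel"
  unfolding emeasure_displaced[OF assms] by measurable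

lemma displaced_emeasure_le:
  fixes E :: "'a::euclidean_space set"
  assumes "E \<in> sets borel"
  shows "emeasure lborel (displaced E h) \<le> emeasure lborel E"
  by (rule emeasure_mono) (use assms in \<open>auto simp: displaced_def\<close>)

text \<open>Most of \<open>E\<close> lies in a ball of radius n. For norm h > 2 n a point x of
  \<open>E\<close> with x - h in \<open>E\<close> has x or x - h outside that ball, so the
  undisplaced part is covered by the remainder of \<open>E\<close> and its translate.\<close>

lemma displaced_measure_at_infinity:
  fixes E :: "'a::euclidean_space set"
  assumes E[measurable]: "E \<in> sets borel" and fin: "emeasure lborel E < \<infinity>" and "e > 0"
  shows "\<exists>R>0. \<forall>h. norm h > R \<longrightarrow> measure lborel E - e \<le> measure lborel (displaced E h)"
proof -
  let ?O = "\<lambda>n::nat. E - cball 0 (real n)"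
  have fm: "E \<in> fmeasurable lborel" using fin by (auto intro!: fmeasurableI)
  have "(\<lambda>n. measure lborel (?O n)) \<longlonglongrightarrow> measure lborel (\<Inter>n. ?O n)"
  proof (rule Lim_measure_decseq)
    show "decseq ?O" by (auto simp: decseq_def)
    show "emeasure lborel (?O n) \<noteq> \<infinity>" for n
      using le_less_trans[OF emeasure_mono fin, of "?O n"] by auto
  qed auto
  also have "(\<Inter>n. ?O n) = {}"
    using real_arch_simple by (auto simp: not_le) 
  finally have "\<forall>\<^sub>F n in sequentially. measure lborel (?O n) < e / 2"
    by (rule order_tendstoD) (use \<open>e > 0\<close> in simp)
  then obtain n where n: "measure lborel (?O n) < e / 2"
    by (auto simp: eventually_sequentially)
  \<comment> \<open>The remainder is counted twice, hence e / 2 above. The extra 1 keeps the radius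
    positive when n = 0.\<close>
  have "measure lborel E - e \<le> measure lborel (displaced E h)" if h: "norm h > 2 * real n + 1" for h
  proof -
    let ?S = "(\<lambda>x. x - h) -` (?O n)"
    have "(\<lambda>x. x - h) -` (?O n) \<inter> space borel \<in> sets borel" by measurable
    then have [measurable]: "?S \<in> sets borel" by simp
    have emS: "emeasure lborel ?S = emeasure lborel (?O n)"
    proof -
      have "emeasure lborel (?O n) = emeasure (distr lborel borel ((+) (- h))) (?O n)"
        by (simp only: lborel_distr_plus)
      also have "\<dots> = emeasure lborel ((+) (- h) -` (?O n) \<inter> space lborel)"
        by (rule emeasure_distr) auto
      also have "(+) (- h) -` (?O n) \<inter> space lborel = ?S" by (simp add: vimage_def)
      finally show ?thesis by simp
    qed
    have "emeasure lborel (?O n) \<le> emeasure lborel E" by (rule emeasure_mono) auto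
    then have fO: "?O n \<in> fmeasurable lborel" "?S \<in> fmeasurable lborel"
      using fin emS by (auto intro!: fmeasurableI)
    have fD: "displaced E h \<in> fmeasurable lborel"
      by (rule fmeasurableI2[OF fm]) (auto simp: displaced_def)
    have "E \<subseteq> displaced E h \<union> (?O n \<union> ?S)"
    proof
      fix x assume "x \<in> E"
      show "x \<in> displaced E h \<union> (?O n \<union> ?S)"
      proof (cases "x - h \<in> E")
        case True
        have "norm h \<le> norm x + norm (x - h)"
          using norm_triangle_ineq4[of x "x - h"] by simp
        then have "norm x > real n \<or> norm (x - h) > real n" using h by linarith
        then show ?thesis using True \<open>x \<in> E\<close> by auto
      qed (use \<open>x \<in> E\<close> in \<open>auto simp: displaced_def\<close>)
    qed
    then have "measure lborel E \<le> measure lborel (displaced E h \<union> (?O n \<union> ?S))"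
      using fD fO by (intro measure_mono_fmeasurable) auto
    also have "\<dots> \<le> measure lborel (displaced E h) + measure lborel (?O n \<union> ?S)"
      using fD fO by (intro measure_Un_le) auto
    also have "measure lborel (?O n \<union> ?S) \<le> measure lborel (?O n) + measure lborel ?S"
      by (intro measure_Un_le) auto
    also have "measure lborel ?S = measure lborel (?O n)" by (simp add: measure_def emS)
    finally show ?thesis using n by simp
  qed
  then show ?thesis by (intro exI[of _ "2 * real n + 1"]) auto
qed

text \<open>Substituting u = \<epsilon> (x - y) in the inner integral removes the scale from the
  kernel; Tonelli then integrates over x first.\<close>

lemma Per_rescaled_kernel:
  fixes J :: "'a::euclidean_space \<Rightarrow> real"
  assumes J[measurable]: "J \<in> borel_measurable lebesgue" and "\<And>x. 0 \<le> J x"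
    and E[measurable]: "E \<in> sets borel" and \<epsilon>: "\<epsilon> > 0"
  shows "Per (rescaled_kernel J \<epsilon>) E =
    (\<integral>\<^sup>+u. ennreal (J u) * emeasure lborel (displaced E (u /\<^sub>R \<epsilon>)) \<partial>lebesgue)"
proof -
  have "(\<lambda>x. ennreal (J x)) \<in> borel_measurable lebesgue" by simp
  \<comment> \<open>A Borel representative of the kernel allows Tonelli to be applied to
    \<open>lborel\<close>.\<close>
  then obtain J' where J'[measurable]: "J' \<in> borel_measurable borel"
    and AE: "AE x in lborel. ennreal (J x) = J' x"
    using completion_ex_borel_measurable[of "\<lambda>x. ennreal (J x)" lborel] by auto
  have inner: "(\<integral>\<^sup>+y\<in>- E. ennreal (rescaled_kernel J \<epsilon> (x - y)) \<partial>lebesgue) =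
      (\<integral>\<^sup>+u. J' u * indicator (- E) (x - u /\<^sub>R \<epsilon>) \<partial>lborel)" for x
  proof -
    let ?f = "\<lambda>u. ennreal (J u) * indicator (- E) (x - u /\<^sub>R \<epsilon>)"
    have [measurable]: "(\<lambda>u. indicator (- E) (x - u /\<^sub>R \<epsilon>) :: ennreal) \<in> borel_measurable lebesgue"
      by (rule measurable_completion) measurable
    have "(\<integral>\<^sup>+u. J' u * indicator (- E) (x - u /\<^sub>R \<epsilon>) \<partial>lborel) = (\<integral>\<^sup>+u. ?f u \<partial>lborel)"
      by (rule nn_integral_cong_AE) (use AE in eventually_elim, simp)
    also have "\<dots> = (\<integral>\<^sup>+u. ?f u \<partial>lebesgue)" by (simp add: nn_integral_completion)
    \<comment> \<open>The homothety sends y to \<epsilon> x - \<epsilon> y; its Jacobian is the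
      prefactor in \<open>rescaled_kernel\<close>.\<close>
    also have "\<dots> = (\<integral>\<^sup>+y. ennreal (\<bar>- \<epsilon>\<bar> ^ DIM('a)) * ?f (\<epsilon> *\<^sub>R x + (- \<epsilon>) *\<^sub>R y) \<partial>lebesgue)"
      by (rule nn_integral_lebesgue_homothety) (use \<epsilon> in simp_all)
    also have "\<dots> = (\<integral>\<^sup>+y\<in>- E. ennreal (rescaled_kernel J \<epsilon> (x - y)) \<partial>lebesgue)"
    proof (rule nn_integral_cong)
      fix y
      have "\<epsilon> *\<^sub>R x + (- \<epsilon>) *\<^sub>R y = \<epsilon> *\<^sub>R (x - y)" by (simp add: algebra_simps)
      then show "ennreal (\<bar>- \<epsilon>\<bar> ^ DIM('a)) * ?f (\<epsilon> *\<^sub>R x + (- \<epsilon>) *\<^sub>R y) =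
          ennreal (rescaled_kernel J \<epsilon> (x - y)) * indicator (- E) y"
        using \<epsilon> assms(2) by (simp add: rescaled_kernel_def ennreal_mult mult.assoc)
    qed
    finally show ?thesis by simp
  qed
  have "Per (rescaled_kernel J \<epsilon>) E =
      (\<integral>\<^sup>+x. (\<integral>\<^sup>+u. J' u * indicator (- E) (x - u /\<^sub>R \<epsilon>) \<partial>lborel) * indicator E x \<partial>lborel)"
    unfolding Per_def inner by (simp add: nn_integral_completion)
  also have "\<dots> = (\<integral>\<^sup>+x. \<integral>\<^sup>+u. J' u * (indicator E x * indicator (- E) (x - u /\<^sub>R \<epsilon>)) \<partial>lborel \<partial>lborel)"
    by (subst nn_integral_multc[symmetric]) (simp_all add: mult_ac)
  also have "\<dots> = (\<integral>\<^sup>+u. \<integral>\<^sup>+x. J' u * (indicator E x * indicator (- E) (x - u /\<^sub>R \<epsilon>)) \<partial>lborel \<partial>lborel)"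
    by (rule lborel_pair.Fubini') measurable
  also have "\<dots> = (\<integral>\<^sup>+u. J' u * emeasure lborel (displaced E (u /\<^sub>R \<epsilon>)) \<partial>lborel)"
    by (simp add: emeasure_displaced nn_integral_cmult)
  also have "\<dots> = (\<integral>\<^sup>+u. ennreal (J u) * emeasure lborel (displaced E (u /\<^sub>R \<epsilon>)) \<partial>lborel)"
    by (rule nn_integral_cong_AE) (use AE in eventually_elim, simp)
  finally show ?thesis by (simp add: nn_integral_completion)
qed

theorem corollary3p17:
  fixes J :: "'a::euclidean_space \<Rightarrow> real" and E :: "'a set"
  assumes "J \<in> borel_measurable lebesgue"
    and "\<forall>x. J x > 0"
    and "\<forall>\<epsilon>>0. integrable lebesgue (\<lambda>x. min 1 (norm x) * rescaled_kernel J \<epsilon> x)"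
    and "slowly_varying_at_zero (tail_mass J)"
    and "E \<in> sets borel"
    and "emeasure lebesgue E < \<infinity>"
    and "finite_perimeter E"
  shows "((\<lambda>\<epsilon>. inverse (ennreal (tail_mass J \<epsilon>)) * Per (rescaled_kernel J \<epsilon>) E)
           \<longlongrightarrow> emeasure lebesgue E) (at_right 0)"
proof -
  interpret moment_kernel J
    using assms(1,2) spec[OF assms(3), of 1] by unfold_locales (auto simp: rescaled_kernel_def)
  note E[measurable] = assms(5)
  have fin: "emeasure lborel E < \<infinity>" using assms(5,6) by simp
  define g where "g h = measure lborel (displaced E h)" for h
  obtain V where V: "\<And>h. g h \<le> V * norm h"
    using displaced_measure_le[OF assms(7,5) fin] unfolding g_def by metis
  have em: "emeasure lborel (displaced E h) = ennreal (g h)" for h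
    using le_less_trans[OF displaced_emeasure_le[OF E, of h] fin]
    by (simp add: g_def emeasure_eq_ennreal_measure less_top)
  have g_le: "g h \<le> measure lborel E" for h
    using displaced_emeasure_le[OF E, of h] fin unfolding g_def measure_def
    by (intro enn2real_mono) auto
  have [measurable]: "g \<in> borel_measurable borel"
    unfolding g_def measure_def by measurable
  note average = tendsto_average[OF assms(4) \<open>g \<in> _\<close>, of "measure lborel E" V,
      OF _ g_le V displaced_measure_at_infinity[OF E fin, folded g_def]]
  have g0: "0 \<le> g h" for h by (simp add: g_def)
  let ?P = "\<lambda>\<epsilon>. \<integral>u. J u * g (u /\<^sub>R \<epsilon>) \<partial>lebesgue"
  \<comment> \<open>For \<epsilon> > 0 the tail mass is positive and the average is a finite
    integral, so the extended quotient comes from a real one.\<close>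
  have "inverse (ennreal (tail_mass J \<epsilon>)) * Per (rescaled_kernel J \<epsilon>) E = ennreal (?P \<epsilon> / tail_mass J \<epsilon>)"
    if "\<epsilon> > 0" for \<epsilon>
  proof -
    have "Per (rescaled_kernel J \<epsilon>) E = (\<integral>\<^sup>+u. ennreal (J u * g (u /\<^sub>R \<epsilon>)) \<partial>lebesgue)"
      by (simp add: Per_rescaled_kernel[OF assms(1) nonneg E that] em ennreal_mult nonneg g0)
    also have "\<dots> = ennreal (?P \<epsilon>)"
      by (rule nn_integral_eq_integral[OF average(1)]) (auto simp: g0 nonneg that)
    finally show ?thesis
      using tail_mass_pos[OF that]
      by (simp add: inverse_ennreal ennreal_mult'[symmetric] divide_inverse mult.commute)
  qed
  then have "\<forall>\<^sub>F \<epsilon> in at_right 0. ennreal (?P \<epsilon> / tail_mass J \<epsilon>) =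
      inverse (ennreal (tail_mass J \<epsilon>)) * Per (rescaled_kernel J \<epsilon>) E"
    using eventually_at_right_less[of "0::real"] by (auto elim: eventually_mono)
  moreover have "((\<lambda>\<epsilon>. ennreal (?P \<epsilon> / tail_mass J \<epsilon>)) \<longlongrightarrow> ennreal (measure lborel E)) (at_right 0)"
    by (intro tendsto_ennrealI average(2) g0)
  moreover have "ennreal (measure lborel E) = emeasure lebesgue E"
    using fin by (simp add: emeasure_eq_ennreal_measure)
  ultimately show ?thesis
    using Lim_transform_eventually by fastforce
qed

end
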